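(* Let $P, Q$ be integers such that either $Q \geq 0$ and $P > 2\sqrt{Q}$, or $Q \geq 0$ and $P < -2\sqrt{Q}$. Then the Lucas sequence of first kind $(U_n(P,Q))_{n\in\mathbb{N}}$ is $\infty$-log concave.
   Context: $\mathbb{N}=\{0,1,2,\dots\}$. For integers $P,Q$ with $P^2-4Q\geq 0$, the Lucas sequence of first kind $U_n=U_n(P,Q)$ is defined by $U_0=0$, $U_1=1$, $U_n=PU_{n-1}-QU_{n-2}$ for $n\geq 2$. Every real sequence $(a_n)_{n\in\mathbb{N}}$ is extended to indices in $\mathbb{Z}$ by the convention $a_n=0$ for $n<0$. The log-operator $\mathcal{L}$ sends a real sequence $(a_n)_{n\in\mathbb{N}}$ to the real sequence $(b_n)_{n\in\mathbb{N}}$ with $b_n=\mathcal{L}(a_n)=a_n^2-a_{n-1}a_{n+1}$ (in particular $b_0=a_0^2$). For an integer $i\geq 1$, $\mathcal{L}^i$ denotes $\mathcal{L}$ applied $i$ times. A real sequence is $\infty$-log concave if $\mathcal{L}^i(a_n)$ is a nonnegative sequence for every integer $i\geq 1$. *)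

theory Defs
  imports Complex_Main
begin

fun lucas_U :: "int \<Rightarrow> int \<Rightarrow> nat \<Rightarrow> int" where
  "lucas_U P Q 0 = 0"
| "lucas_U P Q (Suc 0) = 1"
| "lucas_U P Q (Suc (Suc n)) = P * lucas_U P Q (Suc n) - Q * lucas_U P Q n"

definition extend_int :: "(nat \<Rightarrow> real) \<Rightarrow> int \<Rightarrow> real" where
  "extend_int a k = (if k < 0 then 0 else a (nat k))"

definition log_operator :: "(nat \<Rightarrow> real) \<Rightarrow> nat \<Rightarrow> real" where
  "log_operator a n =
     (extend_int a (int n))\<^sup>2 - extend_int a (int n - 1) * extend_int a (int n + 1)"

definition infinitely_log_concave :: "(nat \<Rightarrow> real) \<Rightarrow> bool" where
  "infinitely_log_concave a \<longleftrightarrow> (\<forall>i\<ge>1. \<forall>n. 0 \<le> (log_operator ^^ i) a n)"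

end

(* The Catalan-type identity U(n+1)^2 - U(n) U(n+2) = Q^n says that one application of the
   log-operator turns the Lucas sequence into 0, 1, Q, Q^2, .... Consecutive
   terms of a geometric sequence satisfy a(n)^2 = a(n-1) a(n+1), so the second application leaves
   0, 1, 0, 0, ..., which is a fixed point. *)
theory Submission
  imports Defs
begin

lemma log_operator_0: "log_operator a 0 = (a 0)\<^sup>2"
  by (simp add: log_operator_def extend_int_def)

lemma log_operator_Suc: "log_operator a (Suc n) = (a (Suc n))\<^sup>2 - a n * a (Suc (Suc n))"
  by (simp add: log_operator_def extend_int_def nat_add_distrib)

text \<open>The left side is a 2 by 2 determinant of consecutive terms; each step of the recurrence
  multiplies it by \<open>Q\<close>, the determinant of the companion matrix.\<close>

lemma lucas_U_identity:
  "(lucas_U P Q (Suc n))\<^sup>2 - lucas_U P Q n * lucas_U P Q (Suc (Suc n)) = Q ^ n"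
proof (induction n)
  case (Suc n)
  have "(lucas_U P Q (Suc (Suc n)))\<^sup>2 - lucas_U P Q (Suc n) * lucas_U P Q (Suc (Suc (Suc n)))
      = Q * ((lucas_U P Q (Suc n))\<^sup>2 - lucas_U P Q n * lucas_U P Q (Suc (Suc n)))"
    by (simp add: algebra_simps power2_eq_square)
  then show ?case
    by (simp only: Suc.IH power_Suc)
qed simp

definition shifted_geometric :: "real \<Rightarrow> nat \<Rightarrow> real" where
  "shifted_geometric q n = (case n of 0 \<Rightarrow> 0 | Suc m \<Rightarrow> q ^ m)"

lemma log_operator_lucas_U:
  "log_operator (\<lambda>n. real_of_int (lucas_U P Q n)) = shifted_geometric (real_of_int Q)"
proof
  fix n
  show "log_operator (\<lambda>n. real_of_int (lucas_U P Q n)) n = shifted_geometric (real_of_int Q) n"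
  proof (cases n)
    case 0
    then show ?thesis by (simp add: log_operator_0 shifted_geometric_def)
  next
    case (Suc m)
    show ?thesis
      using arg_cong[OF lucas_U_identity[of P Q m], of real_of_int]
      by (simp add: Suc log_operator_Suc shifted_geometric_def del: lucas_U.simps)
  qed
qed

(* The sequence 0, 1, 0, 0, ... is the case q = 0, since 0 ^ 0 = 1. *)
lemma log_operator_shifted_geometric:
  "log_operator (shifted_geometric q) = shifted_geometric 0"
proof
  fix n
  \<comment> \<open>Index 1 is separate: its left neighbour is the leading zero, so the square 1
    survives.\<close>
  consider "n = 0" | "n = Suc 0" | m where "n = Suc (Suc m)"
    by (metis nat.exhaust)
  then show "log_operator (shifted_geometric q) n = shifted_geometric 0 n"
    by cases (simp_all add: log_operator_0 log_operator_Suc shifted_geometric_def power2_eq_square)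
qed

lemma shifted_geometric_nonneg: "0 \<le> q \<Longrightarrow> 0 \<le> shifted_geometric q n"
  by (simp add: shifted_geometric_def split: nat.split)

lemma funpow_log_operator_shifted_geometric_nonneg:
  assumes "0 \<le> q"
  shows "0 \<le> (log_operator ^^ i) (shifted_geometric q) n"
  using assms
  \<comment> \<open>Peeling off the innermost application turns \<open>q\<close> into 0, so the
    hypothesis is needed at 0.\<close>
  by (induction i arbitrary: q)
     (simp_all add: funpow_Suc_right log_operator_shifted_geometric shifted_geometric_nonneg
        del: funpow.simps(2))

theorem corollary12:
  fixes P Q :: int
  assumes "(Q \<ge> 0 \<and> real_of_int P > 2 * sqrt (real_of_int Q))
         \<or> (Q \<ge> 0 \<and> real_of_int P < - 2 * sqrt (real_of_int Q))"
  shows "infinitely_log_concave (\<lambda>n. real_of_int (lucas_U P Q n))"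
  unfolding infinitely_log_concave_def
proof (intro allI impI)
  fix i n :: nat
  assume "1 \<le> i"
  \<comment> \<open>One application must be spent first: the Lucas terms themselves can be negative,
    as the term \<open>P\<close> at index 2 is when \<open>P < 0\<close>.\<close>
  then obtain j where i: "i = Suc j"
    by (cases i) auto
  have "0 \<le> real_of_int Q"
    using assms by auto
  then show "0 \<le> (log_operator ^^ i) (\<lambda>n. real_of_int (lucas_U P Q n)) n"
    by (simp add: i funpow_Suc_right log_operator_lucas_U
        funpow_log_operator_shifted_geometric_nonneg del: funpow.simps(2))
qed

end
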